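(* Let $m\ge 2$ be an integer, let $X$ be a real Hilbert space, and let $R\colon X\to X$ be a linear isometry with $R^m=I_X$. Put $A:=\frac1m\sum_{i=1}^m R^i$, $Y:=\{y\in X: Ay=0\}$ and $S:=R-I_X$. Let $C$ be a nonempty closed convex subset of $X$ with support function $\sigma_C$, and let $D:=\{y\in Y:\ \sigma_C(y)+\frac12\|y\|^2\le 0\}$. Then there exist $d,e\in Y$ such that $$d=Se\in D$$ and $$\sigma_C(Se)+\langle Sx-Se,e\rangle-\sigma_C(Sx)\le 0\quad\text{for all }x\in S^{-1}D.$$
   Context: All spaces are real. $I_X$ is the identity on $X$. The support function of $C$ is $\sigma_C(t):=\sup_{c\in C}\langle c,t\rangle\in(-\infty,+\infty]$. $S^{-1}D:=\{x\in X:\ Sx\in D\}$. *)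

theory Defs
  imports "HOL-Analysis.Analysis"
begin

definition linear_isometry :: "('a::real_normed_vector \<Rightarrow> 'b::real_normed_vector) \<Rightarrow> bool" where
  "linear_isometry R \<longleftrightarrow> linear R \<and> (\<forall>x. norm (R x) = norm x)"

(* For nonempty C the value is never -\<infinity>; on the set D_set below it is also less than
   \<infinity>, so sums and differences of its values there are ordinary real ones. *)
definition support_function :: "'a::real_inner set \<Rightarrow> 'a \<Rightarrow> ereal" where
  "support_function C t = (SUP c\<in>C. ereal (c \<bullet> t))"

definition avg_map :: "nat \<Rightarrow> ('a::real_vector \<Rightarrow> 'a) \<Rightarrow> 'a \<Rightarrow> 'a" where
  "avg_map m R x = (1 / real m) *\<^sub>R (\<Sum>i = 1..m. (R ^^ i) x)"

definition Y_space :: "nat \<Rightarrow> ('a::real_vector \<Rightarrow> 'a) \<Rightarrow> 'a set" where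
  "Y_space m R = {y. avg_map m R y = 0}"

definition S_map :: "('a::real_vector \<Rightarrow> 'a) \<Rightarrow> 'a \<Rightarrow> 'a" where
  "S_map R x = R x - x"

definition D_set :: "nat \<Rightarrow> ('a::real_inner \<Rightarrow> 'a) \<Rightarrow> 'a set \<Rightarrow> 'a set" where
  "D_set m R C = {y \<in> Y_space m R. support_function C y + ereal (1/2 * (norm y)\<^sup>2) \<le> 0}"

end

theory Submission
  imports Defs
begin

text \<open>On \<open>Y\<close> the map \<open>S\<close> is invertible, with inverse \<open>Q = (1/m) \<Sum>\<^sub>i\<^sub><\<^sub>m i R\<^sup>i\<close>, and
  since \<open>R\<close> is an isometry, \<open>\<langle>Q y, y\<rangle> = - \<parallel>y\<parallel>\<^sup>2 / 2\<close> there. So \<open>- Q\<close> is Lipschitz and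
  strongly monotone on \<open>D\<close>, and with \<open>e = Q d\<close> the claim is the variational inequality on \<open>D\<close> for
  \<open>- Q\<close> and the convex function \<open>\<sigma>\<^sub>C\<close>, which is finite on \<open>D\<close>. As in the theorem of Lions and
  Stampacchia, a solution is the fixed point of a contraction built from the proximal map.\<close>

section \<open>Variational inequalities of the second kind\<close>

lemma norm_add_scaleR_squared:
  fixes u v :: "'a::real_inner"
  shows "(norm (u + s *\<^sub>R v))\<^sup>2 = (norm u)\<^sup>2 + 2 * s * (u \<bullet> v) + s\<^sup>2 * (norm v)\<^sup>2"
  by (simp add: dot_square_norm[symmetric] inner_add_left inner_add_right inner_commute[of v u]
      power2_eq_square[of s] algebra_simps)

text \<open>The parallelogram law; its last term is the gain that makes a squared distance strongly
  convex.\<close>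

lemma norm_midpoint_squared:
  fixes u v :: "'a::real_inner"
  shows "(norm ((1/2) *\<^sub>R (u + v)))\<^sup>2 = (norm u)\<^sup>2 / 2 + (norm v)\<^sup>2 / 2 - (norm (u - v))\<^sup>2 / 4"
  by (simp add: dot_square_norm[symmetric] inner_add_left inner_add_right inner_diff_left
      inner_diff_right inner_commute[of v u] field_simps del: norm_scaleR)

text \<open>\<open>p\<close> minimises \<open>h y + t/2 \<parallel>y - z\<parallel>\<^sup>2\<close> over \<open>K\<close>; a minimising sequence is Cauchy by strong
  convexity.\<close>

lemma proximal_point_exists:
  fixes h :: "'a::{real_inner, banach} \<Rightarrow> real"
  assumes "K \<noteq> {}" and conv: "convex_on K h" and cl: "closed (epigraph K h)"
    and minor: "\<And>y. y \<in> K \<Longrightarrow> c \<bullet> y + b \<le> h y" and t: "t > 0"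
  shows "\<exists>p\<in>K. \<forall>y\<in>K. h p + t * ((z - p) \<bullet> (y - p)) \<le> h y"
proof -
  define F where "F y = h y + t / 2 * (norm (y - z))\<^sup>2" for y
  define I where "I = Inf (F ` K)"
  have bdd: "bdd_below (F ` K)"
  proof (rule bdd_belowI2)
    fix y assume y: "y \<in> K"
    \<comment> \<open>Completing the square: the quadratic term of \<open>F\<close> absorbs the
      slope \<open>c\<close> of the affine minorant.\<close>
    have "0 \<le> t / 2 * (norm ((y - z) + (1 / t) *\<^sub>R c))\<^sup>2" using t by simp
    also have "\<dots> = t / 2 * (norm (y - z))\<^sup>2 + c \<bullet> (y - z) + (norm c)\<^sup>2 / (2 * t)"
      unfolding norm_add_scaleR_squared
      using t by (simp add: inner_commute[of _ c] field_simps power2_eq_square[of t])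
    finally show "c \<bullet> z + b - (norm c)\<^sup>2 / (2 * t) \<le> F y"
      using minor[OF y] by (simp add: F_def inner_diff_right)
  qed
  have I_le: "I \<le> F y" if "y \<in> K" for y
    unfolding I_def using bdd that by (rule cINF_lower)
  have "\<exists>y\<in>K. F y < I + 1 / real (Suc n)" for n
    using cInf_lessD[of "F ` K" "I + 1 / real (Suc n)"] \<open>K \<noteq> {}\<close> by (auto simp: I_def)
  then obtain x where x: "\<And>n. x n \<in> K" "\<And>n. F (x n) < I + 1 / real (Suc n)"
    by metis
  \<comment> \<open>The midpoint of two points of \<open>K\<close> cannot beat the infimum
    \<open>I\<close>, so two almost minimal points must be close.\<close>
  have mid: "t / 8 * (norm (a - b))\<^sup>2 \<le> (F a + F b) / 2 - I" if "a \<in> K" "b \<in> K" for a b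
  proof -
    let ?m = "(1/2) *\<^sub>R a + (1/2) *\<^sub>R b"
    have m: "?m \<in> K" "h ?m \<le> 1/2 * h a + 1/2 * h b"
      using convexD[of K a b "1/2" "1/2"] convex_onD[OF conv, of "1/2" a b] convex_on_imp_convex[OF conv] that
      by simp_all
    have "?m - z = (1/2) *\<^sub>R ((a - z) + (b - z))"
      by (simp add: algebra_simps flip: scaleR_add_left)
    moreover have "a - b = (a - z) - (b - z)" by simp
    ultimately have norm_m: "(norm (?m - z))\<^sup>2 =
      (norm (a - z))\<^sup>2 / 2 + (norm (b - z))\<^sup>2 / 2 - (norm (a - b))\<^sup>2 / 4"
      by (simp only: norm_midpoint_squared)
    have "F ?m \<le> (F a + F b) / 2 - t / 8 * (norm (a - b))\<^sup>2"
      unfolding F_def norm_m using m(2) by (simp add: algebra_simps)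
    with I_le[OF m(1)] show ?thesis by linarith
  qed
  have "Cauchy x"
  proof (rule CauchyI)
    fix e :: real assume e: "e > 0"
    then obtain N where N: "1 / real (Suc N) < t / 8 * e\<^sup>2"
      using t nat_approx_posE[of "t / 8 * e\<^sup>2"] by (metis divide_pos_pos mult_pos_pos
        zero_less_numeral zero_less_power)
    have small: "F (x n) < I + t / 8 * e\<^sup>2" if "n \<ge> N" for n
    proof -
      have "1 / real (Suc n) \<le> 1 / real (Suc N)" using that by (simp add: frac_le)
      with x(2)[of n] N show ?thesis by linarith
    qed
    have "norm (x m - x n) < e" if "m \<ge> N" "n \<ge> N" for m n
    proof -
      have "t / 8 * (norm (x m - x n))\<^sup>2 < t / 8 * e\<^sup>2"
        using mid[OF x(1)[of m] x(1)[of n]] small[OF that(1)] small[OF that(2)] by argo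
      then show ?thesis
        using t e by (simp add: power_less_imp_less_base)
    qed
    then show "\<exists>M. \<forall>m\<ge>M. \<forall>n\<ge>M. norm (x m - x n) < e" by blast
  qed
  then obtain p where p: "x \<longlonglongrightarrow> p"
    using Cauchy_convergent convergent_def by blast
  have F_lim: "(\<lambda>n. F (x n)) \<longlonglongrightarrow> I"
  proof (rule tendsto_sandwich[of "\<lambda>_. I" _ _ "\<lambda>n. I + 1 / real (Suc n)"])
    show "(\<lambda>n. I + 1 / real (Suc n)) \<longlonglongrightarrow> I"
      using tendsto_add[OF tendsto_const LIMSEQ_inverse_real_of_nat, of I]
      by (simp add: inverse_eq_divide)
    show "\<forall>\<^sub>F n in sequentially. F (x n) \<le> I + 1 / real (Suc n)"
      using x(2) by (intro always_eventually allI less_imp_le)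
  qed (simp_all add: I_le x(1))
  have "(\<lambda>n. F (x n) - t / 2 * (norm (x n - z))\<^sup>2) \<longlonglongrightarrow> I - t / 2 * (norm (p - z))\<^sup>2"
    by (intro tendsto_intros F_lim p)
  then have lim: "(\<lambda>n. (x n, h (x n))) \<longlonglongrightarrow> (p, I - t / 2 * (norm (p - z))\<^sup>2)"
    by (intro tendsto_Pair p) (simp add: F_def)
  \<comment> \<open>The closed epigraph acts as lower semicontinuity of \<open>h\<close>: the limit
    stays in \<open>K\<close> and its value does not exceed \<open>I\<close>.\<close>
  have "(p, I - t / 2 * (norm (p - z))\<^sup>2) \<in> epigraph K h"
    by (rule closed_sequentially[OF cl _ lim]) (simp add: mem_epigraph x(1))
  then have p_K: "p \<in> K" and "F p \<le> I"
    by (auto simp: mem_epigraph F_def)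
  then have F_min: "F p \<le> F y" if "y \<in> K" for y
    using I_le[OF that] by linarith
  have "h p + t * ((z - p) \<bullet> (y - p)) \<le> h y" if y: "y \<in> K" for y
  proof -
    let ?B = "t / 2 * (norm (y - p))\<^sup>2"
    \<comment> \<open>First-order optimality: \<open>p\<close> is compared with a point of the
      segment towards \<open>y\<close>, and the inequality is divided by \<open>s\<close>. The
      remainder \<open>s * ?B\<close> vanishes as \<open>s\<close> tends to 0 from the
      right.\<close>
    have step: "h p + t * ((z - p) \<bullet> (y - p)) - h y \<le> s * ?B" if s: "0 < s" "s < 1" for s
    proof -
      let ?w = "(1 - s) *\<^sub>R p + s *\<^sub>R y"
      have w: "?w \<in> K" "h ?w \<le> (1 - s) * h p + s * h y"
        using convexD[of K p y "1 - s" s] convex_onD[OF conv, of s p y] convex_on_imp_convex[OF conv] p_K y s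
        by simp_all
      have "?w - z = (p - z) + s *\<^sub>R (y - p)" by (simp add: algebra_simps)
      moreover have "(p - z) \<bullet> (y - p) = - ((z - p) \<bullet> (y - p))"
        by (simp add: inner_diff_left)
      ultimately have "(norm (?w - z))\<^sup>2 =
        (norm (p - z))\<^sup>2 - 2 * s * ((z - p) \<bullet> (y - p)) + s\<^sup>2 * (norm (y - p))\<^sup>2"
        by (simp only: norm_add_scaleR_squared)
      then have "F ?w = h ?w + t / 2 * ((norm (p - z))\<^sup>2 - 2 * s * ((z - p) \<bullet> (y - p))
          + s\<^sup>2 * (norm (y - p))\<^sup>2)"
        by (simp add: F_def)
      with F_min[OF w(1)] w(2)
      have "0 \<le> s * (h y - h p - t * ((z - p) \<bullet> (y - p)) + s * ?B)"
        by (simp add: F_def algebra_simps power2_eq_square)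
      with s show ?thesis by (simp add: zero_le_mult_iff)
    qed
    have "((\<lambda>s. s * ?B) \<longlongrightarrow> 0 * ?B) (at_right 0)"
      by (intro tendsto_intros)
    moreover have "\<forall>\<^sub>F s in at_right 0. h p + t * ((z - p) \<bullet> (y - p)) - h y \<le> s * ?B"
      by (rule eventually_mono[OF eventually_at_right_real[of 0 1]]) (use step in auto)
    ultimately have "h p + t * ((z - p) \<bullet> (y - p)) - h y \<le> 0 * ?B"
      by (rule tendsto_lowerbound) simp
    then show ?thesis by simp
  qed
  with p_K show ?thesis by blast
qed

text \<open>A point that is the proximal point of \<open>d - (1/t) T d\<close> for \<open>d\<close>
  equal to itself solves the inequality, since the factor \<open>t\<close> cancels. For large
  \<open>t\<close> the step along \<open>- T\<close> shrinks distances, and the proximal map does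
  not increase them.\<close>

theorem variational_inequality_solvable:
  fixes h :: "'a::{real_inner, banach} \<Rightarrow> real" and T :: "'a \<Rightarrow> 'a"
  assumes "K \<noteq> {}" "closed K" and "convex_on K h" "closed (epigraph K h)"
    and minor: "\<And>y. y \<in> K \<Longrightarrow> c \<bullet> y + b \<le> h y"
    and lip: "L-lipschitz_on K T" and "\<alpha> > 0"
    and mono: "\<And>x y. x \<in> K \<Longrightarrow> y \<in> K \<Longrightarrow> \<alpha> * (norm (x - y))\<^sup>2 \<le> (T x - T y) \<bullet> (x - y)"
  shows "\<exists>d\<in>K. \<forall>y\<in>K. h d + T d \<bullet> (d - y) \<le> h y"
proof -
  \<comment> \<open>This gives \<open>L\<^sup>2 \<le> \<alpha> * t\<close>, so the squared factor
    \<open>1 - 2\<alpha>/t + L\<^sup>2/t\<^sup>2\<close> is at most \<open>1 - \<alpha>/t\<close>.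
    The summand 1 keeps \<open>t\<close> positive when \<open>L = 0\<close>.\<close>
  define t where "t = (L\<^sup>2 + 1) / \<alpha>"
  have t: "t > 0" using \<open>\<alpha> > 0\<close> by (simp add: t_def add_nonneg_pos)
  have "\<forall>d. \<exists>p\<in>K. \<forall>y\<in>K. h p + t * ((d - (1 / t) *\<^sub>R T d - p) \<bullet> (y - p)) \<le> h y"
    using proximal_point_exists[OF assms(1,3,4) minor t] by blast
  then obtain G where G: "\<And>d. G d \<in> K"
    "\<And>d y. y \<in> K \<Longrightarrow> h (G d) + t * ((d - (1 / t) *\<^sub>R T d - G d) \<bullet> (y - G d)) \<le> h y"
    by metis
  \<comment> \<open>The maximum keeps the radicand nonnegative: on a one-point \<open>K\<close>,
    \<open>\<alpha>\<close> may exceed \<open>t\<close>.\<close>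
  define q where "q = sqrt (max 0 (1 - \<alpha> / t))"
  have q: "0 \<le> q" "q < 1" using \<open>\<alpha> > 0\<close> t by (auto simp: q_def)
  have "dist (G x) (G y) \<le> q * dist x y" if x: "x \<in> K" and y: "y \<in> K" for x y
  proof -
    define u where "u = x - y"
    define v where "v = T x - T y"
    define w where "w = G x - G y"
    let ?a = "x - (1 / t) *\<^sub>R T x - G x" and ?b = "y - (1 / t) *\<^sub>R T y - G y"
    \<comment> \<open>The inequality of each proximal point is tested at the other one; in the sum
      the values of \<open>h\<close> cancel.\<close>
    have "t * (?a \<bullet> - w) + t * (?b \<bullet> w) \<le> 0"
      using G(2)[OF G(1), of x y] G(2)[OF G(1), of y x] by (simp add: w_def)
    moreover have "u - (1 / t) *\<^sub>R v - w = ?a - ?b"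
      by (simp add: u_def v_def w_def algebra_simps)
    ultimately have "t * ((u - (1 / t) *\<^sub>R v - w) \<bullet> w) \<ge> 0"
      by (simp only: inner_diff_left[of ?a ?b]) (simp add: right_diff_distrib)
    then have "(u - (1 / t) *\<^sub>R v - w) \<bullet> w \<ge> 0" using t by (simp add: zero_le_mult_iff)
    then have "norm w * norm w \<le> (u - (1 / t) *\<^sub>R v) \<bullet> w"
      by (simp only: inner_diff_left[of _ w]) (simp add: norm_eq_sqrt_inner)
    also have "\<dots> \<le> norm (u - (1 / t) *\<^sub>R v) * norm w" by (rule norm_cauchy_schwarz)
    finally have "norm w \<le> norm (u - (1 / t) *\<^sub>R v)"
      by (cases "w = 0") auto
    then have "(norm w)\<^sup>2 \<le> (norm (u - (1 / t) *\<^sub>R v))\<^sup>2" by (simp add: power_mono)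
    also have "\<dots> = (norm u)\<^sup>2 - 2 / t * (v \<bullet> u) + (norm v)\<^sup>2 / t\<^sup>2"
      using norm_add_scaleR_squared[of u "- (1 / t)" v]
      by (simp add: inner_commute[of v u] power_divide)
    also have "\<dots> \<le> (norm u)\<^sup>2 - 2 / t * (\<alpha> * (norm u)\<^sup>2) + (L * norm u)\<^sup>2 / t\<^sup>2"
    proof -
      have "2 / t * (\<alpha> * (norm u)\<^sup>2) \<le> 2 / t * (v \<bullet> u)"
        using mono[OF x y] t by (intro mult_left_mono) (auto simp: u_def v_def)
      moreover have "(norm v)\<^sup>2 / t\<^sup>2 \<le> (L * norm u)\<^sup>2 / t\<^sup>2"
        using lipschitz_on_normD[OF lip x y]
        by (intro divide_right_mono power_mono) (auto simp: u_def v_def)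
      ultimately show ?thesis by linarith
    qed
    also have "\<dots> = (1 - 2 * \<alpha> / t + L\<^sup>2 / t\<^sup>2) * (norm u)\<^sup>2"
      by (simp add: algebra_simps power_mult_distrib)
    also have "\<dots> \<le> (max 0 (1 - \<alpha> / t)) * (norm u)\<^sup>2"
    proof (rule mult_right_mono)
      have "L\<^sup>2 \<le> \<alpha> * t" using \<open>\<alpha> > 0\<close> by (simp add: t_def)
      then have "L\<^sup>2 / t\<^sup>2 \<le> \<alpha> / t" using t by (simp add: divide_simps power2_eq_square)
      then show "1 - 2 * \<alpha> / t + L\<^sup>2 / t\<^sup>2 \<le> max 0 (1 - \<alpha> / t)" by simp
    qed simp
    also have "\<dots> = (q * norm u)\<^sup>2" by (simp add: q_def power_mult_distrib)
    finally have "norm w \<le> q * norm u"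
      by (rule power2_le_imp_le) (use q in simp)
    then show ?thesis by (simp add: dist_norm u_def w_def)
  qed
  then obtain d where d: "d \<in> K" "G d = d"
    using Banach_fix[of K q G] \<open>closed K\<close> \<open>K \<noteq> {}\<close> q G(1)
    by (auto simp: complete_eq_closed image_subset_iff)
  have "h d + T d \<bullet> (d - y) \<le> h y" if "y \<in> K" for y
    using G(2)[OF that, of d] d t by (simp add: inner_diff_right right_diff_distrib)
  with d(1) show ?thesis by blast
qed

section \<open>Periodic linear isometries\<close>

definition S_inv :: "nat \<Rightarrow> ('a::real_vector \<Rightarrow> 'a) \<Rightarrow> 'a \<Rightarrow> 'a" where
  "S_inv m R y = (1 / real m) *\<^sub>R (\<Sum>i<m. real i *\<^sub>R (R ^^ i) y)"

lemma linear_funpow: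
  fixes R :: "'a::real_vector \<Rightarrow> 'a"
  assumes "linear R" shows "linear (R ^^ i)"
proof (induction i)
  case (Suc i)
  then show ?case using linear_compose[OF Suc assms] by (simp add: o_def)
qed (simp add: linear_id[unfolded id_def])

lemma norm_funpow_isometry:
  fixes R :: "'a::real_normed_vector \<Rightarrow> 'a"
  assumes "linear_isometry R" shows "norm ((R ^^ i) x) = norm x"
  by (induction i) (use assms in \<open>auto simp: linear_isometry_def\<close>)

lemma linear_avg_map:
  assumes "linear R" shows "linear (avg_map m R)"
  unfolding avg_map_def
  by (intro linear_compose_scale_right linear_compose_sum ballI linear_funpow assms)

lemma linear_S_inv:
  assumes "linear R" shows "linear (S_inv m R)"
  unfolding S_inv_def
  by (intro linear_compose_scale_right linear_compose_sum ballI linear_funpow assms)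

lemma subspace_Y_space:
  assumes "linear R" shows "subspace (Y_space m R)"
  unfolding Y_space_def using linear_subspace_kernel[OF linear_avg_map[OF assms]] .

text \<open>Any finite Lipschitz constant will do, so each weight \<open>i\<close> is simply bounded
  by \<open>m\<close>.\<close>

lemma norm_S_inv_le:
  fixes R :: "'a::real_normed_vector \<Rightarrow> 'a"
  assumes "linear_isometry R" shows "norm (S_inv m R y) \<le> real m * norm y"
proof -
  have "norm (\<Sum>i<m. real i *\<^sub>R (R ^^ i) y) \<le> (\<Sum>i<m. real m * norm y)"
    by (rule sum_norm_le) (auto simp: norm_funpow_isometry[OF assms] mult_right_mono)
  then show ?thesis
    by (cases "m = 0") (auto simp: S_inv_def field_simps)
qed

lemma closed_Y_space:
  fixes R :: "'a::real_normed_vector \<Rightarrow> 'a"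
  assumes "linear_isometry R" shows "closed (Y_space m R)"
proof -
  have "bounded_linear (R ^^ i)" for i
    using assms linear_funpow[of R i] norm_funpow_isometry[OF assms, of i]
    by (intro bounded_linear_intro[of _ 1])
      (auto simp: linear_isometry_def linear_add linear_scale)
  then have "continuous_on UNIV (avg_map m R)"
    unfolding avg_map_def by (intro continuous_intros linear_continuous_on)
  then show ?thesis
    unfolding Y_space_def by (intro closed_Collect_eq continuous_on_const)
qed

lemma avg_map_funpow:
  assumes "linear R" shows "avg_map m R ((R ^^ j) x) = (R ^^ j) (avg_map m R x)"
proof -
  have "(R ^^ i) ((R ^^ j) x) = (R ^^ j) ((R ^^ i) x)" for i
    by (metis add.commute comp_apply funpow_add)
  then show ?thesis
    using linear_funpow[OF assms, of j] by (simp add: avg_map_def linear_scale linear_sum)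
qed

text \<open>The averaging map commutes with the powers of \<open>R\<close>, so it kills every
  summand of \<open>S_inv m R y\<close>. This places the witness \<open>e\<close> in
  \<open>Y\<close>.\<close>

lemma S_inv_mem_Y_space:
  assumes "linear R" "y \<in> Y_space m R" shows "S_inv m R y \<in> Y_space m R"
  using linear_avg_map[OF assms(1), of m] linear_funpow[OF assms(1)] assms
  by (simp add: Y_space_def S_inv_def linear_scale linear_sum avg_map_funpow linear_0)

text \<open>Summation by parts: applying \<open>R\<close> shifts the weighted sum, and subtracting
  the sum leaves a boundary term minus an unweighted sum. At \<open>k = m\<close> the boundary term
  is \<open>m y\<close> by periodicity, and the unweighted sum is \<open>m\<close> times the
  average, which is 0.\<close>

lemma S_map_S_inv:
  assumes "linear R" "R ^^ m = id" "m > 0" "y \<in> Y_space m R"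
  shows "S_map R (S_inv m R y) = y"
proof -
  have "R (\<Sum>i<k. real i *\<^sub>R (R ^^ i) y) - (\<Sum>i<k. real i *\<^sub>R (R ^^ i) y)
      = real k *\<^sub>R (R ^^ k) y - (\<Sum>i=1..k. (R ^^ i) y)" for k
  proof (induction k)
    case 0
    then show ?case using linear_0[OF assms(1)] by simp
  next
    case (Suc k)
    then show ?case using assms(1)
      by (simp add: linear_add linear_scale algebra_simps)
  qed
  from this[of m] have "R (\<Sum>i<m. real i *\<^sub>R (R ^^ i) y) - (\<Sum>i<m. real i *\<^sub>R (R ^^ i) y)
      = real m *\<^sub>R y"
    using assms(2-4) by (simp add: Y_space_def avg_map_def)
  moreover have "S_map R (S_inv m R y) = (1 / real m) *\<^sub>R
      (R (\<Sum>i<m. real i *\<^sub>R (R ^^ i) y) - (\<Sum>i<m. real i *\<^sub>R (R ^^ i) y))"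
    using assms(1) by (simp add: S_map_def S_inv_def linear_scale scaleR_diff_right)
  ultimately show ?thesis using \<open>m > 0\<close> by simp
qed

text \<open>Expand the norm of \<open>R x = x + S x\<close> and use that it equals the norm of
  \<open>x\<close>. At \<open>x = Q y\<close> this yields the strong monotonicity of
  \<open>- Q\<close>.\<close>

lemma inner_S_map_isometry:
  fixes R :: "'a::real_inner \<Rightarrow> 'a"
  assumes "linear_isometry R"
  shows "x \<bullet> S_map R x = - (1/2) * (norm (S_map R x))\<^sup>2"
proof -
  have "R x \<bullet> R x = x \<bullet> x"
    using assms by (simp add: linear_isometry_def flip: power2_norm_eq_inner)
  then show ?thesis
    by (simp add: S_map_def power2_norm_eq_inner algebra_simps inner_commute)
qed

section \<open>The support function on \<open>D\<close>\<close>

lemma mem_D_set_iff: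
  assumes "C \<noteq> {}"
  shows "y \<in> D_set m R C \<longleftrightarrow> y \<in> Y_space m R \<and> (\<forall>c\<in>C. c \<bullet> y + 1/2 * (norm y)\<^sup>2 \<le> 0)"
proof -
  have "support_function C y + ereal r \<le> 0 \<longleftrightarrow> (\<forall>c\<in>C. c \<bullet> y + r \<le> 0)" for r
  proof -
    have "support_function C y + ereal r \<le> 0 \<longleftrightarrow> support_function C y \<le> ereal (- r)"
      by (cases "support_function C y") auto
    also have "\<dots> \<longleftrightarrow> (\<forall>c\<in>C. c \<bullet> y + r \<le> 0)"
      by (auto simp: support_function_def SUP_le_iff)
    finally show ?thesis .
  qed
  then show ?thesis by (auto simp: D_set_def)
qed

text \<open>Completing the square turns the condition for each \<open>c\<close> into membership in a
  ball. Closedness and convexity of \<open>D\<close> can then be read off.\<close>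

lemma D_set_eq_cball:
  assumes "C \<noteq> {}"
  shows "D_set m R C = Y_space m R \<inter> (\<Inter>c\<in>C. cball (- c) (norm c))"
proof -
  have "c \<bullet> y + 1/2 * (norm y)\<^sup>2 \<le> 0 \<longleftrightarrow> y \<in> cball (- c) (norm c)" for c y :: 'a
  proof -
    have "y \<in> cball (- c) (norm c) \<longleftrightarrow> (norm (c + y))\<^sup>2 \<le> (norm c)\<^sup>2"
      by (simp add: dist_norm norm_minus_commute power2_le_iff_abs_le add.commute)
    also have "\<dots> \<longleftrightarrow> c \<bullet> y + 1/2 * (norm y)\<^sup>2 \<le> 0"
      by (simp add: power2_norm_eq_inner inner_add_left inner_add_right inner_commute[of y c])
        argo
    finally show ?thesis by simp
  qed
  then show ?thesis using mem_D_set_iff[OF assms, of _ m R] by auto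
qed

text \<open>On \<open>D\<close> every inner product is at most 0, and any single \<open>c\<close>
  gives a finite lower bound, so the supremum is real.\<close>

lemma support_function_eq_ereal:
  assumes "C \<noteq> {}" "y \<in> D_set m R C"
  shows "support_function C y = ereal (SUP c\<in>C. c \<bullet> y)"
proof -
  have le: "support_function C y \<le> 0"
    unfolding support_function_def
  proof (rule SUP_least)
    fix c assume "c \<in> C"
    then have "c \<bullet> y + 1/2 * (norm y)\<^sup>2 \<le> 0"
      using assms(2) by (simp add: mem_D_set_iff[OF assms(1)])
    then have "c \<bullet> y \<le> 0"
      using zero_le_power2[of "norm y"] by linarith
    then show "ereal (c \<bullet> y) \<le> 0" by simp
  qed
  obtain c where "c \<in> C" using assms(1) by blast
  then have "ereal (c \<bullet> y) \<le> support_function C y"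
    unfolding support_function_def by (rule SUP_upper)
  with le have "\<bar>support_function C y\<bar> \<noteq> \<infinity>"
    by (cases "support_function C y") auto
  then show ?thesis
    unfolding support_function_def by (rule ereal_SUP[symmetric])
qed

theorem lemma6:
  fixes m :: nat
    and R :: "'a::{real_inner, banach} \<Rightarrow> 'a"
    and C :: "'a set"
  assumes "m \<ge> 2"
    and "linear_isometry R"
    and "R ^^ m = id"
    and "C \<noteq> {}" and "closed C" and "convex C"
  shows "\<exists>d\<in>Y_space m R. \<exists>e\<in>Y_space m R.
           d = S_map R e \<and> S_map R e \<in> D_set m R C \<and>
           (\<forall>x \<in> S_map R -` D_set m R C.
              support_function C (S_map R e) + ereal ((S_map R x - S_map R e) \<bullet> e)
                - support_function C (S_map R x) \<le> 0)"
proof -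
  define D where "D = D_set m R C"
  define Q where "Q = S_inv m R"
  \<comment> \<open>The real supremum is meaningful where the values are bounded above; this holds
    on \<open>D\<close>, so the facts on \<open>h\<close> are stated there.\<close>
  define h where "h y = (SUP c\<in>C. c \<bullet> y)" for y
  have lin: "linear R" using assms(2) by (simp add: linear_isometry_def)
  have D_iff: "y \<in> D \<longleftrightarrow> y \<in> Y_space m R \<and> (\<forall>c\<in>C. c \<bullet> y + 1/2 * (norm y)\<^sup>2 \<le> 0)" for y
    unfolding D_def by (rule mem_D_set_iff[OF assms(4)])
  have h_le: "h y \<le> r \<longleftrightarrow> (\<forall>c\<in>C. c \<bullet> y \<le> r)" if "y \<in> D" for y r
    unfolding h_def
  proof (rule cSUP_le_iff[OF assms(4)])
    show "bdd_above ((\<lambda>c. c \<bullet> y) ` C)"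
      using that by (intro bdd_aboveI2[of _ _ "- (1/2 * (norm y)\<^sup>2)"]) (force simp: D_iff)
  qed
  have h_ge: "c \<bullet> y \<le> h y" if "c \<in> C" "y \<in> D" for c y
    using h_le[OF that(2), of "h y"] that(1) by simp
  have "0 \<in> D" using subspace_0[OF subspace_Y_space[OF lin]] by (simp add: D_iff)
  have "closed D" "convex D"
    unfolding D_def D_set_eq_cball[OF assms(4)]
    using closed_Y_space[OF assms(2)] subspace_imp_convex[OF subspace_Y_space[OF lin]]
    by (auto intro!: closed_Int closed_INT convex_Int convex_INT)
  \<comment> \<open>A supremum of continuous linear functions has an epigraph cut out by closed
    half-spaces.\<close>
  have "epigraph D h = (D \<times> UNIV) \<inter> (\<Inter>c\<in>C. {z. c \<bullet> fst z \<le> snd z})"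
    by (auto simp: mem_epigraph h_le)
  then have "closed (epigraph D h)"
    using \<open>closed D\<close>
    by (auto intro!: closed_Int closed_INT closed_Times closed_Collect_le continuous_intros)
  moreover have "convex_on D h"
    unfolding convex_on_def
  proof (intro conjI ballI allI impI)
    fix x y and u v :: real assume *: "x \<in> D" "y \<in> D" "0 \<le> u" "0 \<le> v" "u + v = 1"
    then have "u *\<^sub>R x + v *\<^sub>R y \<in> D" using \<open>convex D\<close> by (auto intro: convexD)
    then show "h (u *\<^sub>R x + v *\<^sub>R y) \<le> u * h x + v * h y"
      using * h_ge by (auto simp: h_le inner_add_right intro!: add_mono mult_left_mono)
  qed fact
  \<comment> \<open>Any \<open>c\<close> in \<open>C\<close> serves as a linear minorant of
    \<open>h\<close>, with constant term 0.\<close>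
  moreover obtain c where "c \<in> C" using assms(4) by blast
  moreover have "(real m)-lipschitz_on D (\<lambda>y. - Q y)"
  proof (rule lipschitz_onI)
    fix x y
    have "dist (- Q x) (- Q y) = norm (Q (x - y))"
      using linear_diff[OF linear_S_inv[OF lin]] by (simp add: dist_norm Q_def norm_minus_commute)
    then show "dist (- Q x) (- Q y) \<le> real m * dist x y"
      using norm_S_inv_le[OF assms(2)] by (simp add: Q_def dist_norm)
  qed simp
  moreover have "1/2 * (norm (x - y))\<^sup>2 \<le> (- Q x - - Q y) \<bullet> (x - y)" if "x \<in> D" "y \<in> D" for x y
  proof -
    have "x - y \<in> Y_space m R"
      using that subspace_diff[OF subspace_Y_space[OF lin]] by (auto simp: D_iff)
    then have "S_map R (Q (x - y)) = x - y"
      using S_map_S_inv[OF lin assms(3)] assms(1) by (simp add: Q_def)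
    then have "Q (x - y) \<bullet> (x - y) = - (1/2) * (norm (x - y))\<^sup>2"
      using inner_S_map_isometry[OF assms(2), of "Q (x - y)"] by simp
    then show ?thesis
      using linear_diff[OF linear_S_inv[OF lin, of m]] by (simp add: Q_def inner_diff_left)
  qed
  ultimately have "\<exists>d\<in>D. \<forall>y\<in>D. h d + - Q d \<bullet> (d - y) \<le> h y"
    using \<open>0 \<in> D\<close> \<open>closed D\<close> h_ge
    by (intro variational_inequality_solvable[where c = c and b = 0 and L = "real m" and \<alpha> = "1/2"]) auto
  then obtain d where d: "d \<in> D" "\<And>y. y \<in> D \<Longrightarrow> h d + - Q d \<bullet> (d - y) \<le> h y"
    by blast
  have dY: "d \<in> Y_space m R" using d(1) by (simp add: D_iff)
  have SQ: "S_map R (Q d) = d"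
    using S_map_S_inv[OF lin assms(3) _ dY] assms(1) by (simp add: Q_def)
  \<comment> \<open>The claim involves \<open>x\<close> only through \<open>y = S x\<close> in
    \<open>D\<close>. The sign of \<open>- Q d\<close> is absorbed by exchanging \<open>d\<close>
    and \<open>y\<close>.\<close>
  have "support_function C d + ereal ((y - d) \<bullet> Q d) - support_function C y \<le> 0"
    if "y \<in> D" for y
    using d(2)[OF that] support_function_eq_ereal[OF assms(4), of _ m R] d(1) that
    by (simp add: h_def D_def inner_commute inner_diff_right)
  with SQ d(1) dY S_inv_mem_Y_space[OF lin dY] show ?thesis
    by (intro bexI[of _ d] bexI[of _ "Q d"]) (auto simp: D_def Q_def)
qed

end
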